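(* Let $X$ be a set, $E$ a nonempty set of parameters, $N\ge 1$ an integer, and let $(X,\mathcal{T}_i,N,E)$ be a soft $N$-topological space over $X$ with soft topologies $\mathcal{T}_1,\dots,\mathcal{T}_N$. If $(X,\mathcal{T}_i,N,E)$ is an $N$-wise soft $T_0$-space, then the supremum soft topological space $\left(X,\bigvee_{i=1}^N\mathcal{T}_i,E\right)$ is a soft $T_0$-space.
   Context: A soft set over $X$ (with respect to the fixed nonempty parameter set $E$) is a pair $(F,E)$ where $F:E\to\mathcal{P}(X)$ is any map. The null soft set has $F(e)=\emptyset$ for all $e$; the absolute soft set has $F(e)=X$ for all $e$. Soft unions and soft intersections are defined parameterwise: the soft union of $\{(F_i,E)\}_{i\in I}$ is given by $e\mapsto\bigcup_i F_i(e)$ and the soft intersection of $(F,E)$ and $(G,E)$ by $e\mapsto F(e)\cap G(e)$. A soft topology on $X$ with respect to $E$ is a family $\mathcal{T}$ of soft sets over $X$ that contains the null and the absolute soft sets, and is closed under soft intersections of two members and under arbitrary soft unions; then $(X,\mathcal{T},E)$ is a soft topological space. A soft $N$-topological space $(X,\mathcal{T}_i,N,E)$ over $X$ is the set $X$ equipped with $N$ different soft topologies $\mathcal{T}_1,\dots,\mathcal{T}_N$ on $X$ with respect to the same $E$. A soft set is a soft $N$-open set if it belongs to $\mathcal{T}_j$ for some $j\in\{1,\dots,N\}$. The supremum soft topology $\bigvee_{i=1}^N\mathcal{T}_i$ is the smallest soft topology on $X$ containing the ordinary union $\bigcup_{i=1}^N\mathcal{T}_i$. For $x\in X$ and $\alpha\in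 E$, the soft point $(x_\alpha,E)$ is the soft set with value $\{x\}$ at $\alpha$ and $\emptyset$ at every other parameter. It soft belongs to $(F,E)$ iff $x\in F(\alpha)$. Soft points $(x_\alpha,E)$ and $(y_\beta,E)$ are distinct iff $x\ne y$ or $\alpha\ne\beta$. $(X,\mathcal{T},E)$ is a soft $T_0$-space if for every pair of distinct soft points over $X$ there is a member of $\mathcal{T}$ to which exactly one of the two soft points soft belongs. $(X,\mathcal{T}_i,N,E)$ is an $N$-wise soft $T_0$-space if for every pair of distinct soft points over $X$ there is a soft $N$-open set to which exactly one of the two soft points soft belongs. *)

theory Defs
  imports "HOL-Library.FuncSet"
begin

text \<open>
  A soft set over \<open>X\<close> with parameter set \<open>E\<close> is a map from \<open>E\<close> to the subsets of \<open>X\<close>. Maps are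
  taken to be extensional, i.e. they have the value \<open>undefined\<close> outside \<open>E\<close>, so that HOL equality
  of soft sets is equality as maps on \<open>E\<close>.
\<close>

definition soft_sets :: "'a set \<Rightarrow> 'e set \<Rightarrow> ('e \<Rightarrow> 'a set) set" where
  "soft_sets X E = (E \<rightarrow>\<^sub>E Pow X)"

definition soft_null :: "'e set \<Rightarrow> 'e \<Rightarrow> 'a set" where
  "soft_null E = (\<lambda>e\<in>E. {})"

definition soft_absolute :: "'a set \<Rightarrow> 'e set \<Rightarrow> 'e \<Rightarrow> 'a set" where
  "soft_absolute X E = (\<lambda>e\<in>E. X)"

definition soft_inter :: "'e set \<Rightarrow> ('e \<Rightarrow> 'a set) \<Rightarrow> ('e \<Rightarrow> 'a set) \<Rightarrow> 'e \<Rightarrow> 'a set" where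
  "soft_inter E F G = (\<lambda>e\<in>E. F e \<inter> G e)"

definition soft_Union :: "'e set \<Rightarrow> ('e \<Rightarrow> 'a set) set \<Rightarrow> 'e \<Rightarrow> 'a set" where
  "soft_Union E \<F> = (\<lambda>e\<in>E. \<Union>F\<in>\<F>. F e)"

definition soft_topology :: "'a set \<Rightarrow> 'e set \<Rightarrow> ('e \<Rightarrow> 'a set) set \<Rightarrow> bool" where
  "soft_topology X E \<T> \<longleftrightarrow>
     \<T> \<subseteq> soft_sets X E \<and>
     soft_null E \<in> \<T> \<and>
     soft_absolute X E \<in> \<T> \<and>
     (\<forall>F\<in>\<T>. \<forall>G\<in>\<T>. soft_inter E F G \<in> \<T>) \<and>
     (\<forall>\<F>. \<F> \<subseteq> \<T> \<longrightarrow> soft_Union E \<F> \<in> \<T>)"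

text \<open>Injectivity on the indices expresses that the \<open>N\<close> soft topologies are different.\<close>

definition soft_N_topological_space ::
  "'a set \<Rightarrow> (nat \<Rightarrow> ('e \<Rightarrow> 'a set) set) \<Rightarrow> nat \<Rightarrow> 'e set \<Rightarrow> bool" where
  "soft_N_topological_space X \<T> N E \<longleftrightarrow>
     (\<forall>i\<in>{1..N}. soft_topology X E (\<T> i)) \<and> inj_on \<T> {1..N}"

definition soft_N_open ::
  "(nat \<Rightarrow> ('e \<Rightarrow> 'a set) set) \<Rightarrow> nat \<Rightarrow> ('e \<Rightarrow> 'a set) \<Rightarrow> bool" where
  "soft_N_open \<T> N F \<longleftrightarrow> (\<exists>j\<in>{1..N}. F \<in> \<T> j)"

text \<open>
  The order on families is inclusion. The least element exists whenever all \<open>\<T> i\<close> consist of soft sets over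
  \<open>X\<close>: then \<open>soft_sets X E\<close> is a soft topology containing them, and the intersection of a
  nonempty family of soft topologies is a soft topology.
\<close>

definition supremum_soft_topology ::
  "'a set \<Rightarrow> (nat \<Rightarrow> ('e \<Rightarrow> 'a set) set) \<Rightarrow> nat \<Rightarrow> 'e set \<Rightarrow> ('e \<Rightarrow> 'a set) set" where
  "supremum_soft_topology X \<T> N E =
     (LEAST \<S>. soft_topology X E \<S> \<and> (\<Union>i\<in>{1..N}. \<T> i) \<subseteq> \<S>)"

definition soft_point :: "'e set \<Rightarrow> 'a \<Rightarrow> 'e \<Rightarrow> 'e \<Rightarrow> 'a set" where
  "soft_point E x \<alpha> = (\<lambda>e\<in>E. if e = \<alpha> then {x} else {})"

definition soft_points :: "'a set \<Rightarrow> 'e set \<Rightarrow> ('e \<Rightarrow> 'a set) set" where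
  "soft_points X E = {soft_point E x \<alpha> | x \<alpha>. x \<in> X \<and> \<alpha> \<in> E}"

definition soft_belongs :: "'e set \<Rightarrow> ('e \<Rightarrow> 'a set) \<Rightarrow> ('e \<Rightarrow> 'a set) \<Rightarrow> bool" where
  "soft_belongs E p F \<longleftrightarrow> (\<exists>x. \<exists>\<alpha>\<in>E. p = soft_point E x \<alpha> \<and> x \<in> F \<alpha>)"

text \<open>
  So distinctness of soft points can be stated as inequality of soft sets.
\<close>

lemma soft_point_eq_iff:
  assumes "\<alpha> \<in> E" "\<beta> \<in> E"
  shows "soft_point E x \<alpha> = soft_point E y \<beta> \<longleftrightarrow> x = y \<and> \<alpha> = \<beta>"
proof
  assume "soft_point E x \<alpha> = soft_point E y \<beta>"
  then have "soft_point E x \<alpha> \<alpha> = soft_point E y \<beta> \<alpha>" by simp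
  with assms show "x = y \<and> \<alpha> = \<beta>" by (auto simp: soft_point_def split: if_splits)
qed simp

lemma soft_belongs_soft_point_iff:
  "\<alpha> \<in> E \<Longrightarrow> soft_belongs E (soft_point E x \<alpha>) F \<longleftrightarrow> x \<in> F \<alpha>"
  by (auto simp: soft_belongs_def soft_point_eq_iff)

definition soft_T0_space :: "'a set \<Rightarrow> ('e \<Rightarrow> 'a set) set \<Rightarrow> 'e set \<Rightarrow> bool" where
  "soft_T0_space X \<T> E \<longleftrightarrow>
     soft_topology X E \<T> \<and>
     (\<forall>p\<in>soft_points X E. \<forall>q\<in>soft_points X E. p \<noteq> q \<longrightarrow>
        (\<exists>F\<in>\<T>. soft_belongs E p F \<noteq> soft_belongs E q F))"

definition N_wise_soft_T0_space ::
  "'a set \<Rightarrow> (nat \<Rightarrow> ('e \<Rightarrow> 'a set) set) \<Rightarrow> nat \<Rightarrow> 'e set \<Rightarrow> bool" where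
  "N_wise_soft_T0_space X \<T> N E \<longleftrightarrow>
     soft_N_topological_space X \<T> N E \<and>
     (\<forall>p\<in>soft_points X E. \<forall>q\<in>soft_points X E. p \<noteq> q \<longrightarrow>
        (\<exists>F. soft_N_open \<T> N F \<and> soft_belongs E p F \<noteq> soft_belongs E q F))"

end

theory Submission
  imports Defs
begin

text \<open>
  Every soft \<open>N\<close>-open set belongs to the supremum soft topology, so a soft \<open>N\<close>-open set
  separating two soft points is already a separating member of the supremum. The only point that
  needs an argument is that the supremum, defined as a least element, really is a soft topology
  containing every \<open>\<T> i\<close>: it is the intersection of all soft topologies containing the union of
  the \<open>\<T> i\<close>, a nonempty family because the discrete soft topology belongs to it.
\<close>

lemma soft_topology_soft_sets: "soft_topology X E (soft_sets X E)"
  unfolding soft_topology_def soft_sets_def soft_null_def soft_absolute_def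
    soft_inter_def soft_Union_def
proof (intro conjI ballI allI impI)
  fix F G assume "F \<in> E \<rightarrow>\<^sub>E Pow X" "G \<in> E \<rightarrow>\<^sub>E Pow X"
  then show "(\<lambda>e\<in>E. F e \<inter> G e) \<in> E \<rightarrow>\<^sub>E Pow X"
    by (auto simp: PiE_iff)
next
  fix \<F> assume "\<F> \<subseteq> E \<rightarrow>\<^sub>E Pow X"
  then have "F e \<subseteq> X" if "F \<in> \<F>" "e \<in> E" for F e
    using that by (auto simp: PiE_iff)
  then show "(\<lambda>e\<in>E. \<Union>F\<in>\<F>. F e) \<in> E \<rightarrow>\<^sub>E Pow X"
    by (auto simp: PiE_iff)
qed auto

lemma soft_topology_Inter:
  assumes "C \<noteq> {}" and "\<And>\<S>. \<S> \<in> C \<Longrightarrow> soft_topology X E \<S>"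
  shows "soft_topology X E (\<Inter>C)"
  unfolding soft_topology_def
proof (intro conjI ballI allI impI)
  show "\<Inter>C \<subseteq> soft_sets X E"
    using assms unfolding soft_topology_def by blast
next
  fix \<F> assume "\<F> \<subseteq> \<Inter>C"
  then have "\<F> \<subseteq> \<S>" if "\<S> \<in> C" for \<S>
    using that by blast
  then show "soft_Union E \<F> \<in> \<Inter>C"
    using assms(2) by (auto simp: soft_topology_def)
qed (use assms(2) in \<open>auto simp: soft_topology_def\<close>)

text \<open>
  A term \<open>LEAST\<close> has its intended value only when a least element exists. The intersection of all
  soft topologies above the \<open>\<T> i\<close> is one; the assumption guarantees that the discrete soft
  topology is among the sets being intersected.
\<close>

lemma supremum_soft_topology_Inter:
  assumes "\<And>i. i \<in> {1..N} \<Longrightarrow> \<T> i \<subseteq> soft_sets X E"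
  shows "soft_topology X E (supremum_soft_topology X \<T> N E)"
    and "supremum_soft_topology X \<T> N E =
      \<Inter>{\<S>. soft_topology X E \<S> \<and> (\<Union>i\<in>{1..N}. \<T> i) \<subseteq> \<S>}"
proof -
  let ?C = "{\<S>. soft_topology X E \<S> \<and> (\<Union>i\<in>{1..N}. \<T> i) \<subseteq> \<S>}"
  have "soft_sets X E \<in> ?C"
    using assms soft_topology_soft_sets by blast
  then have top: "soft_topology X E (\<Inter>?C)"
    by (intro soft_topology_Inter) auto
  show eq: "supremum_soft_topology X \<T> N E = \<Inter>?C"
    unfolding supremum_soft_topology_def
  proof (rule Least_equality)
    show "soft_topology X E (\<Inter>?C) \<and> (\<Union>i\<in>{1..N}. \<T> i) \<subseteq> \<Inter>?C"
      using top by blast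
  qed blast
  show "soft_topology X E (supremum_soft_topology X \<T> N E)"
    using top by (simp only: eq)
qed

lemma soft_N_open_in_supremum:
  assumes "\<And>i. i \<in> {1..N} \<Longrightarrow> \<T> i \<subseteq> soft_sets X E" and "soft_N_open \<T> N F"
  shows "F \<in> supremum_soft_topology X \<T> N E"
proof -
  have "supremum_soft_topology X \<T> N E =
      \<Inter>{\<S>. soft_topology X E \<S> \<and> (\<Union>i\<in>{1..N}. \<T> i) \<subseteq> \<S>}"
    using assms(1) by (rule supremum_soft_topology_Inter(2))
  with assms(2) show ?thesis
    unfolding soft_N_open_def by blast
qed

theorem proposition4p5:
  fixes X :: "'a set" and E :: "'e set" and N :: nat
    and \<T> :: "nat \<Rightarrow> ('e \<Rightarrow> 'a set) set"
  assumes "E \<noteq> {}"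
    and "N \<ge> 1"
    and "soft_N_topological_space X \<T> N E"
    and "N_wise_soft_T0_space X \<T> N E"
  shows "soft_T0_space X (supremum_soft_topology X \<T> N E) E"
proof -
  have sub: "\<T> i \<subseteq> soft_sets X E" if "i \<in> {1..N}" for i
    using assms(3) that unfolding soft_N_topological_space_def soft_topology_def by blast
  show ?thesis
    unfolding soft_T0_space_def
  proof (intro conjI ballI impI)
    show "soft_topology X E (supremum_soft_topology X \<T> N E)"
      using sub by (rule supremum_soft_topology_Inter(1))
  next
    fix p q assume "p \<in> soft_points X E" "q \<in> soft_points X E" "p \<noteq> q"
    then obtain F where "soft_N_open \<T> N F" "soft_belongs E p F \<noteq> soft_belongs E q F"
      using assms(4) unfolding N_wise_soft_T0_space_def by blast
    moreover from sub this(1) have "F \<in> supremum_soft_topology X \<T> N E"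
      by (rule soft_N_open_in_supremum)
    ultimately show "\<exists>F\<in>supremum_soft_topology X \<T> N E. soft_belongs E p F \<noteq> soft_belongs E q F"
      by blast
  qed
qed

end
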